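(* Let $D=L\rightarrow R$, where $L$ and $R$ are two oriented graphs with $\operatorname{inv}(L) = \operatorname{inv}(R) = 1$. Then for any decycling family $(X_1, X_2)$ of $D$ (of two sets), either $X_1\subset V(L)$ and $X_2\subset V(R)$, or $X_1\subset V(R)$ and $X_2\subset V(L)$.
   Context: An oriented graph is a digraph with no loops, no multiple arcs and no directed cycle of length 2. Inverting a vertex set $X$ means reversing every arc with both ends in $X$. A decycling family of $D$ is a family of subsets of $V(D)$ such that inverting them successively yields an acyclic digraph (an arc is reversed iff an odd number of the sets contain both its ends). $\operatorname{inv}(D)$ is the minimum size of a decycling family. The dijoin $L\rightarrow R$ is obtained from the disjoint union of $L$ and $R$ by adding all arcs from $V(L)$ to $V(R)$. *)

theory Defs
  imports "Graph_Theory.Graph_Theory"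
begin

text \<open>Multiple arcs are excluded by the type \<^typ>\<open>'a pair_pre_digraph\<close>; the locale
  \<^locale>\<open>pair_digraph\<close> adds finiteness and the absence of loops.\<close>

locale oriented_graph = pair_digraph +
  assumes no_2_cycle: "(u, v) \<in> parcs G \<Longrightarrow> (v, u) \<notin> parcs G"

definition acyclic_digraph :: "'a pair_pre_digraph \<Rightarrow> bool" where
  "acyclic_digraph G \<longleftrightarrow> (\<nexists>p. pre_digraph.cycle (with_proj G) p)"

definition invert :: "'a pair_pre_digraph \<Rightarrow> 'a set \<Rightarrow> 'a pair_pre_digraph" where
  "invert G X =
    \<lparr> pverts = pverts G,
      parcs = {(u, v). (u, v) \<in> parcs G \<and> \<not> (u \<in> X \<and> v \<in> X)} \<union>
              {(v, u) | u v. (u, v) \<in> parcs G \<and> u \<in> X \<and> v \<in> X} \<rparr>"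

text \<open>A family of sets is a list, so repetitions are allowed and its size is its length.\<close>

definition decycling_family :: "'a pair_pre_digraph \<Rightarrow> 'a set list \<Rightarrow> bool" where
  "decycling_family G Xs \<longleftrightarrow>
    (\<forall>X \<in> set Xs. X \<subseteq> pverts G) \<and> acyclic_digraph (foldl invert G Xs)"

text \<open>The minimum exists for every oriented graph, see \<open>ex_decycling_family\<close> below.\<close>

definition inversion_number :: "'a pair_pre_digraph \<Rightarrow> nat" where
  "inversion_number G = (LEAST k. \<exists>Xs. decycling_family G Xs \<and> length Xs = k)"

text \<open>This is the dijoin only if \<open>L\<close> and \<open>R\<close> have disjoint vertex sets.\<close>

definition dijoin :: "'a pair_pre_digraph \<Rightarrow> 'a pair_pre_digraph \<Rightarrow> 'a pair_pre_digraph" where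
  "dijoin L R =
    \<lparr> pverts = pverts L \<union> pverts R,
      parcs = parcs L \<union> parcs R \<union> pverts L \<times> pverts R \<rparr>"

lemma (in pair_wf_digraph) acyclic_digraph_iff: "acyclic_digraph G \<longleftrightarrow> acyclic (parcs G)"
proof
  assume A: "acyclic_digraph G"
  show "acyclic (parcs G)"
  proof (rule acyclicI, intro allI notI)
    fix x assume "(x, x) \<in> (parcs G)\<^sup>+"
    then obtain p where "awalk x p x" "p \<noteq> []"
      using reachable1_awalk by auto
    then have "closed_w p" by (auto simp: closed_w_def)
    then show False using closed_w_imp_cycle A by (auto simp: acyclic_digraph_def)
  qed
next
  assume A: "acyclic (parcs G)"
  have False if "cycle p" for p
  proof -
    from that obtain u where "awalk u p u" "p \<noteq> []" by (auto simp: cycle_def)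
    then have "(u, u) \<in> (parcs G)\<^sup>+" using reachable1_awalk by auto
    with A show False by (auto simp: acyclic_def)
  qed
  then show "acyclic_digraph G" by (auto simp: acyclic_digraph_def)
qed

lemma pverts_invert [simp]: "pverts (invert G X) = pverts G"
  by (simp add: invert_def)

lemma pverts_foldl_invert [simp]: "pverts (foldl invert G Xs) = pverts G"
  by (induction Xs arbitrary: G) simp_all

lemma arc_invert_iff:
  "(u, v) \<in> parcs (invert G X) \<longleftrightarrow> (if u \<in> X \<and> v \<in> X then (v, u) else (u, v)) \<in> parcs G"
  by (auto simp: invert_def)

lemma arc_foldl_invert_iff:
  "(u, v) \<in> parcs (foldl invert G Xs) \<longleftrightarrow>
    (if odd (length (filter (\<lambda>X. u \<in> X \<and> v \<in> X) Xs)) then (v, u) else (u, v)) \<in> parcs G"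
proof (induction Xs arbitrary: G)
  case (Cons X Xs)
  have "filter (\<lambda>X. v \<in> X \<and> u \<in> X) Xs = filter (\<lambda>X. u \<in> X \<and> v \<in> X) Xs"
    by (rule filter_cong) auto
  with Cons show ?case by (auto simp: arc_invert_iff)
qed simp

lemma pair_wf_digraph_foldl_invert:
  assumes "pair_wf_digraph G" shows "pair_wf_digraph (foldl invert G Xs)"
proof -
  interpret pair_wf_digraph G by fact
  show ?thesis
    by unfold_locales (auto simp: arc_foldl_invert_iff wellformed' split: if_splits)
qed

lemma (in oriented_graph) ex_decycling_family: "\<exists>Xs. decycling_family G Xs"
proof -
  obtain f :: "'a \<Rightarrow> nat" where f: "inj_on f (pverts G)"
    using finite_imp_inj_to_nat_seg pair_finite_verts by blast
  define B where "B = {(u, v) \<in> parcs G. f v < f u}"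
  have "finite B" unfolding B_def by (rule finite_subset[OF _ pair_finite_arcs]) auto
  then obtain bs where bs: "set bs = B" "distinct bs"
    using finite_distinct_list by blast
  define Xs where "Xs = map (\<lambda>(u, v). {u, v}) bs"
  have odd_iff: "odd (length (filter (\<lambda>X. u \<in> X \<and> v \<in> X) Xs)) \<longleftrightarrow> (u, v) \<in> B"
    if uv: "(u, v) \<in> parcs G" for u v
  proof -
    have nvu: "(v, u) \<notin> parcs G" and ne: "u \<noteq> v"
      using uv no_2_cycle pair_no_loops by fastforce+
    have "filter ((\<lambda>X. u \<in> X \<and> v \<in> X) \<circ> (\<lambda>(u, v). {u, v})) bs = filter (\<lambda>e. e = (u, v)) bs"
      using nvu ne bs(1) by (intro filter_cong) (auto simp: B_def)
    then have "length (filter (\<lambda>X. u \<in> X \<and> v \<in> X) Xs) = card (set (filter (\<lambda>e. e = (u, v)) bs))"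
      using bs(2) by (simp add: Xs_def filter_map distinct_card del: set_filter)
    also have "set (filter (\<lambda>e. e = (u, v)) bs) = (if (u, v) \<in> B then {(u, v)} else {})"
      using bs(1) by auto
    finally show ?thesis by simp
  qed
  have "f u < f v" if "(u, v) \<in> parcs (foldl invert G Xs)" for u v
  proof (cases "odd (length (filter (\<lambda>X. u \<in> X \<and> v \<in> X) Xs))")
    case True
    then have vu: "(v, u) \<in> parcs G" using that by (simp add: arc_foldl_invert_iff)
    have "filter (\<lambda>X. v \<in> X \<and> u \<in> X) Xs = filter (\<lambda>X. u \<in> X \<and> v \<in> X) Xs"
      by (rule filter_cong) auto
    then have "(v, u) \<in> B" using True odd_iff[OF vu] by simp
    then show ?thesis by (simp add: B_def)
  next
    case False
    then have uv: "(u, v) \<in> parcs G" using that by (simp add: arc_foldl_invert_iff)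
    then have "\<not> f v < f u" using odd_iff[OF uv] False by (simp add: B_def)
    moreover have "f u \<noteq> f v"
      using uv f pair_no_loops[OF uv] by (auto dest: inj_onD wellformed')
    ultimately show ?thesis by simp
  qed
  then have "parcs (foldl invert G Xs) \<subseteq> measure f" by auto
  then have "acyclic (parcs (foldl invert G Xs))"
    using acyclic_subset wf_acyclic wf_measure by blast
  moreover have "\<forall>X \<in> set Xs. X \<subseteq> pverts G"
    using bs(1) by (auto simp: Xs_def B_def dest: wellformed')
  ultimately show ?thesis
    using pair_wf_digraph.acyclic_digraph_iff pair_wf_digraph_foldl_invert[of G] pair_wf_digraph_axioms
    unfolding decycling_family_def by blast
qed

end

theory Submission
  imports Defs
begin

text \<open>
  Record for each vertex its type, the pair of truth values telling whether it lies in \<open>X\<^sub>1\<close> and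
  in \<open>X\<^sub>2\<close>; an arc is reversed iff the scalar product over \<open>GF(2)\<close> of the types of its ends is 1.
  A vertex \<open>r\<close> of \<open>R\<close> splits \<open>L\<close> into the vertices orthogonal to it, which precede \<open>r\<close> after the
  inversions, and the others, which follow \<open>r\<close>; so all inverted arcs of \<open>L\<close> between the two parts
  go from the first to the second. If \<open>R\<close> contains too many types, this orders the types of \<open>L\<close>
  linearly, and since \<open>L\<close> is acyclic on each single type (there it is kept or reversed as
  a whole), \<open>L\<close> itself would be acyclic. The roles of \<open>L\<close> and \<open>R\<close> are exchanged by reversing all
  arcs, and the remaining combinations of types either contain a directed 4-cycle or are the ones
  claimed.
\<close>

definition odd_common :: "'a set \<Rightarrow> 'a set \<Rightarrow> 'a \<Rightarrow> 'a \<Rightarrow> bool" where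
  "odd_common X Y u v \<longleftrightarrow> (u \<in> X \<and> v \<in> X) \<noteq> (u \<in> Y \<and> v \<in> Y)"

text \<open>Acts on bare relations, so that it also applies to one side of a dijoin and to
  converses.\<close>

definition invert2 :: "'a set \<Rightarrow> 'a set \<Rightarrow> 'a rel \<Rightarrow> 'a rel" where
  "invert2 X Y E = {(u, v). (if odd_common X Y u v then (v, u) else (u, v)) \<in> E}"

lemma odd_common_sym: "odd_common X Y u v \<longleftrightarrow> odd_common X Y v u"
  by (auto simp: odd_common_def)

lemma odd_common_swap: "odd_common Y X = odd_common X Y"
  by (auto simp: odd_common_def fun_eq_iff)

lemma invert2_swap: "invert2 Y X E = invert2 X Y E"
  by (simp add: invert2_def odd_common_swap)

lemma invert2_converse: "invert2 X Y (E\<inverse>) = (invert2 X Y E)\<inverse>"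
  by (auto simp: invert2_def odd_common_sym split: if_splits)

lemma invert2_mono: "E \<subseteq> F \<Longrightarrow> invert2 X Y E \<subseteq> invert2 X Y F"
  by (auto simp: invert2_def)

lemma mem_invert2I:
  "(u, v) \<in> E \<Longrightarrow> odd_common X Y u v \<Longrightarrow> (v, u) \<in> invert2 X Y E"
  "(u, v) \<in> E \<Longrightarrow> \<not> odd_common X Y u v \<Longrightarrow> (u, v) \<in> invert2 X Y E"
  by (auto simp: invert2_def odd_common_sym)

lemma parcs_foldl_invert_two:
  "parcs (foldl invert G [X, Y]) = invert2 X Y (parcs G)"
  by (auto simp: invert2_def odd_common_def arc_foldl_invert_iff simp del: foldl.simps split: if_splits)

text \<open>\<open>h\<close> cannot decrease along a walk, so a closed walk stays within one
  layer.\<close>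

lemma acyclic_if_layers_acyclic:
  fixes h :: "'a \<Rightarrow> nat"
  assumes mono: "\<And>u v. (u, v) \<in> E \<Longrightarrow> h u \<le> h v"
    and layer: "\<And>i. acyclic {(u, v) \<in> E. h u = i \<and> h v = i}"
  shows "acyclic E"
proof (rule acyclicI, intro allI notI)
  have *: "h u \<le> h v \<and> (h u = h v \<longrightarrow> (u, v) \<in> {(u', v') \<in> E. h u' = h u \<and> h v' = h u}\<^sup>+)"
    if "(u, v) \<in> E\<^sup>+" for u v
    using that
  proof induction
    case (base v)
    then show ?case using mono by auto
  next
    case (step v w)
    then have "h u \<le> h v" "h v \<le> h w" using mono by auto
    moreover have "(u, w) \<in> {(u', v') \<in> E. h u' = h u \<and> h v' = h u}\<^sup>+" if "h u = h w"
    proof (rule trancl_into_trancl)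
      have eq: "h u = h v" "h v = h w" using that \<open>h u \<le> h v\<close> \<open>h v \<le> h w\<close> by simp_all
      show "(u, v) \<in> {(u', v') \<in> E. h u' = h u \<and> h v' = h u}\<^sup>+" using step.IH eq by blast
      show "(v, w) \<in> {(u', v') \<in> E. h u' = h u \<and> h v' = h u}" using step.hyps eq by simp
    qed
    ultimately show ?case by auto
  qed
  fix u assume "(u, u) \<in> E\<^sup>+"
  from *[OF this] layer[of "h u"] show False by (auto simp: acyclic_def)
qed

text \<open>A layer of \<open>h\<close> holds a single type, whose scalar product with itself
  decides whether the arcs inside the layer are all reversed or all kept.\<close>

lemma acyclic_if_types_ordered:
  fixes h :: "'a \<Rightarrow> nat"
  assumes ac: "acyclic (invert2 X Y E)"
    and mono: "\<And>u v. (u, v) \<in> E \<Longrightarrow> h u \<le> h v"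
    and inj: "\<And>u v. h u = h v \<Longrightarrow> (u \<in> X \<longleftrightarrow> v \<in> X) \<and> (u \<in> Y \<longleftrightarrow> v \<in> Y)"
  shows "acyclic E"
proof (rule acyclic_if_layers_acyclic[OF mono])
  fix i
  let ?F = "{(u, v) \<in> E. h u = i \<and> h v = i}"
  show "acyclic ?F"
  proof (cases "\<exists>w. h w = i \<and> odd_common X Y w w")
    case True
    then obtain w where w: "h w = i" "odd_common X Y w w" by blast
    have "odd_common X Y u v" if "h u = i" "h v = i" for u v
      using inj[of u w] inj[of v w] that w by (simp add: odd_common_def)
    then have "?F\<inverse> \<subseteq> invert2 X Y E" by (auto intro: mem_invert2I)
    with ac have "acyclic (?F\<inverse>)" by (rule acyclic_subset)
    then show ?thesis by (simp only: acyclic_converse)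
  next
    case False
    have "\<not> odd_common X Y u v" if "h u = i" "h v = i" for u v
      using inj[of u v] that False by (auto simp: odd_common_def)
    then have "?F \<subseteq> invert2 X Y E" by (auto intro: mem_invert2I)
    with ac show ?thesis by (rule acyclic_subset)
  qed
qed

text \<open>Write 10, 01, 11, 00 for the types \<open>X - Y\<close>, \<open>Y - X\<close>,
  \<open>X \<inter> Y\<close> and neither. With only 00 and 11 in \<open>V\<close>, all scalar
  products vanish and no arc is reversed.\<close>

lemma types_of_nonacyclic:
  assumes ac: "acyclic (invert2 X Y E)" and cyc: "\<not> acyclic E" and V: "E \<subseteq> V \<times> V"
  shows "V \<inter> (X - Y) \<noteq> {} \<or> V \<inter> (Y - X) \<noteq> {}"
proof (rule ccontr)
  assume "\<not> ?thesis"
  then have eq: "w \<in> X \<longleftrightarrow> w \<in> Y" if "w \<in> V" for w using that by blast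
  have "E \<subseteq> invert2 X Y E" using V eq by (auto simp: odd_common_def intro!: mem_invert2I(2))
  with ac have "acyclic E" by (rule acyclic_subset)
  with cyc show False ..
qed

text \<open>By \<open>none\<close>, \<open>V\<close> has only the types 00, 10, 11. Arcs between 10
  and 11 are reversed, those at 00 are not. So by \<open>sep\<close>, arcs of \<open>E\<close>
  between different types obey: 00 -> 10 and 00 -> 11 if 10 occurs in \<open>W\<close>; 00 -> 11 ->
  10 if 01 does; 00 -> 10 -> 11 if 11 does.\<close>

lemma types_across_dijoin:
  assumes ac: "acyclic (invert2 X Y E)" and cyc: "\<not> acyclic E" and V: "E \<subseteq> V \<times> V"
    and sep: "\<forall>r\<in>W. \<forall>(u, v)\<in>invert2 X Y E. odd_common X Y u r \<longrightarrow> odd_common X Y v r"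
    and none: "V \<inter> (Y - X) = {}"
  shows "W \<inter> (X - Y) \<noteq> {} \<Longrightarrow> W \<inter> (Y - X) = {}"
    and "W \<inter> (X - Y) \<noteq> {} \<Longrightarrow> V \<inter> (X \<inter> Y) \<noteq> {}"
    and "W \<inter> (X - Y) \<noteq> {} \<or> W \<inter> (Y - X) \<noteq> {} \<Longrightarrow> W \<inter> (X \<inter> Y) = {}"
proof -
  \<comment> \<open>\<open>h\<close> orders 00, 10, 11 and \<open>k\<close> orders 00, 11, 10; the
    value 3 for the absent type 01 only keeps them injective on types.\<close>
  define h where "h u = (if u \<in> X then if u \<in> Y then 2 else 1 else if u \<in> Y then 3 else (0::nat))" for u
  define k where "k u = (if u \<in> X then if u \<in> Y then 1 else 2 else if u \<in> Y then 3 else (0::nat))" for u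
  have inj: "h u = h v \<Longrightarrow> (u \<in> X \<longleftrightarrow> v \<in> X) \<and> (u \<in> Y \<longleftrightarrow> v \<in> Y)"
    "k u = k v \<Longrightarrow> (u \<in> X \<longleftrightarrow> v \<in> X) \<and> (u \<in> Y \<longleftrightarrow> v \<in> Y)" for u v
    by (auto simp: h_def k_def split: if_splits)
  \<comment> \<open>As \<open>E\<close> has a cycle, each of the two orders is violated by some
    arc.\<close>
  have "\<exists>u v. (u, v) \<in> E \<and> h v < h u" "\<exists>u v. (u, v) \<in> E \<and> k v < k u"
    using acyclic_if_types_ordered[OF ac _ inj(1)] acyclic_if_types_ordered[OF ac _ inj(2)] cyc
    by (meson not_le)+
  then obtain u v u' v' where uv: "(u, v) \<in> E" "h v < h u" and uv': "(u', v') \<in> E" "k v' < k u'"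
    by blast
  have no: "w \<notin> Y \<or> w \<in> X" if "w \<in> {u, v, u', v'}" for w
    using that none V uv(1) uv'(1) by auto
  have sep': "if odd_common X Y a b then odd_common X Y b r \<longrightarrow> odd_common X Y a r
      else odd_common X Y a r \<longrightarrow> odd_common X Y b r" if "r \<in> W" "(a, b) \<in> E" for r a b
    using bspec[OF bspec[OF sep that(1)] mem_invert2I(1)[OF that(2)]]
      bspec[OF bspec[OF sep that(1)] mem_invert2I(2)[OF that(2)]] by auto
  note s = sep'[OF _ uv(1)] sep'[OF _ uv'(1)]
  \<comment> \<open>Types 10 and 01 in \<open>W\<close> together force the order
    \<open>k\<close>.\<close>
  have 1: False if "r \<in> W" "r \<in> X" "r \<notin> Y" "s \<in> W" "s \<notin> X" "s \<in> Y" for r s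
    using s(2)[OF that(1)] s(2)[OF that(4)] that uv'(2) no[of u'] no[of v']
    by (simp add: odd_common_def k_def split: if_splits)
  have 2: "\<exists>w \<in> V. w \<in> X \<and> w \<in> Y" if "r \<in> W" "r \<in> X" "r \<notin> Y" for r
  \<comment> \<open>Type 10 puts 00 first, so a descent of \<open>h\<close> can only go from 11 to
    10.\<close>
  proof -
    have "u \<in> X \<and> u \<in> Y \<or> v \<in> X \<and> v \<in> Y"
      using s(1)[OF that(1)] that uv(2) no[of u] no[of v]
      by (simp add: odd_common_def h_def split: if_splits)
    then show ?thesis using uv(1) V by blast
  qed
  \<comment> \<open>Type 11 with 10 or 01 forces the order \<open>h\<close>.\<close>
  have 3: False if "r \<in> W" "r \<in> X \<longleftrightarrow> r \<notin> Y" "s \<in> W" "s \<in> X" "s \<in> Y" for r s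
    using s(1)[OF that(1)] s(1)[OF that(3)] that uv(2) no[of u] no[of v]
    by (simp add: odd_common_def h_def split: if_splits)
  show "W \<inter> (X - Y) \<noteq> {} \<Longrightarrow> W \<inter> (Y - X) = {}"
    using 1 by blast
  show "W \<inter> (X - Y) \<noteq> {} \<Longrightarrow> V \<inter> (X \<inter> Y) \<noteq> {}"
    using 2 by blast
  show "W \<inter> (X - Y) \<noteq> {} \<or> W \<inter> (Y - X) \<noteq> {} \<Longrightarrow> W \<inter> (X \<inter> Y) = {}"
    using 3 by blast
qed

lemma types_of_dijoin:
  assumes ac: "acyclic (invert2 X Y (E \<union> F \<union> V \<times> W))"
    and cyc: "\<not> acyclic E" "\<not> acyclic F" and sub: "E \<subseteq> V \<times> V" "F \<subseteq> W \<times> W"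
  shows "V \<inter> Y = {} \<and> W \<inter> X = {} \<or> V \<inter> X = {} \<and> W \<inter> Y = {}"
proof -
  let ?I = "invert2 X Y" and ?D = "E \<union> F \<union> V \<times> W"
  have acE: "acyclic (?I E)" and acF: "acyclic (?I F)"
    by (auto intro!: acyclic_subset[OF ac] invert2_mono)
  have cross: "(r, l) \<in> ?I ?D" if "l \<in> V" "r \<in> W" "odd_common X Y l r" for l r
    using that by (auto intro: mem_invert2I)
  have cross': "(l, r) \<in> ?I ?D" if "l \<in> V" "r \<in> W" "\<not> odd_common X Y l r" for l r
    using that by (auto intro: mem_invert2I)
  have no3: False if "(a, b) \<in> ?I ?D" "(b, c) \<in> ?I ?D" "(c, a) \<in> ?I ?D" for a b c
    using that ac unfolding acyclic_def by (meson trancl.intros)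
  have no4: False if "(a, b) \<in> ?I ?D" "(b, c) \<in> ?I ?D" "(c, d) \<in> ?I ?D" "(d, a) \<in> ?I ?D" for a b c d
    using that ac unfolding acyclic_def by (meson trancl.intros)
  have inE: "u \<in> V \<and> v \<in> V \<and> (u, v) \<in> ?I ?D" if "(u, v) \<in> ?I E" for u v
    using that sub(1) by (auto simp: invert2_def split: if_splits)
  have inF: "u \<in> W \<and> v \<in> W \<and> (u, v) \<in> ?I ?D" if "(u, v) \<in> ?I F" for u v
    using that sub(2) by (auto simp: invert2_def split: if_splits)
  \<comment> \<open>Otherwise u -> v -> r -> u is a directed triangle.\<close>
  have sepE: "odd_common X Y v r" if "r \<in> W" "(u, v) \<in> ?I E" "odd_common X Y u r" for r u v
    using that inE[OF that(2)] cross cross' no3 by meson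
  \<comment> \<open>Here the triangle is v -> u -> l -> v; taking \<open>F\<inverse>\<close> gives
    the right side the same form as the left.\<close>
  have sepF: "odd_common X Y v l" if "l \<in> V" "(u, v) \<in> ?I (F\<inverse>)" "odd_common X Y u l" for l u v
    using that inF[of v u] cross cross' no3
    unfolding invert2_converse converse_iff odd_common_sym[of X Y _ l] by meson
  have acF': "acyclic (?I (F\<inverse>))" and cycF': "\<not> acyclic (F\<inverse>)" and subF': "F\<inverse> \<subseteq> W \<times> W"
    using acF cyc(2) sub(2) by (auto simp: invert2_converse acyclic_converse)
  have sepE': "\<forall>r\<in>W. \<forall>(u, v)\<in>?I E. odd_common X Y u r \<longrightarrow> odd_common X Y v r"
    and sepF': "\<forall>l\<in>V. \<forall>(u, v)\<in>?I (F\<inverse>). odd_common X Y u l \<longrightarrow> odd_common X Y v l"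
    using sepE sepF by blast+
  note swap = invert2_swap[of Y X] odd_common_swap[of Y X]
  note L = types_across_dijoin[OF acE cyc(1) sub(1) sepE']
    types_across_dijoin[of Y X, unfolded swap, OF acE cyc(1) sub(1) sepE']
    types_of_nonacyclic[OF acE cyc(1) sub(1)]
  note R = types_across_dijoin[OF acF' cycF' subF' sepF']
    types_across_dijoin[of Y X, unfolded swap, OF acF' cycF' subF' sepF']
    types_of_nonacyclic[OF acF cyc(2) sub(2)]
  \<comment> \<open>The directed 4-cycle is b -> r -> a -> s -> b.\<close>
  have "False" if "a \<in> V \<inter> (X - Y)" "b \<in> V \<inter> (Y - X)" "r \<in> W \<inter> (X - Y)" "s \<in> W \<inter> (Y - X)" for a b r s
    using that no4[of b r a s] cross[of a r] cross[of b s] cross'[of b r] cross'[of a s]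
    by (auto simp: odd_common_def)
  then have four: "V \<inter> (X - Y) = {} \<or> V \<inter> (Y - X) = {} \<or> W \<inter> (X - Y) = {} \<or> W \<inter> (Y - X) = {}"
    by blast
  have comm: "Y \<inter> X = X \<inter> Y" by blast
  \<comment> \<open>By \<open>four\<close> and symmetry, let \<open>V\<close> miss 01. Then
    \<open>V\<close> has 10, and \<open>W\<close> has 10 or 01, hence misses 11. If \<open>W\<close>
    had 10, it would miss 01 and \<open>V\<close> would have 11, against \<open>R\<close>. So
    \<open>W\<close> has 01 and misses 10, and \<open>R\<close> excludes 11 from
    \<open>V\<close>.\<close>
  have "V \<inter> (Y - X) = {} \<and> V \<inter> (X \<inter> Y) = {} \<and> W \<inter> (X - Y) = {} \<and> W \<inter> (X \<inter> Y) = {} \<or>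
    V \<inter> (X - Y) = {} \<and> V \<inter> (X \<inter> Y) = {} \<and> W \<inter> (Y - X) = {} \<and> W \<inter> (X \<inter> Y) = {}"
    using L R four unfolding comm by argo
  then show ?thesis by blast
qed

lemma not_acyclic_if_inversion_number_pos:
  assumes "inversion_number G > 0" shows "\<not> acyclic_digraph G"
proof
  assume "acyclic_digraph G"
  then have "decycling_family G [] \<and> length ([] :: 'a set list) = 0" by (simp add: decycling_family_def)
  then have "inversion_number G \<le> 0" unfolding inversion_number_def by (intro Least_le exI)
  with assms show False by simp
qed

theorem theorem3p3:
  fixes L R D :: "'a pair_pre_digraph" and X\<^sub>1 X\<^sub>2 :: "'a set"
  assumes "oriented_graph L" and "oriented_graph R"
    and "pverts L \<inter> pverts R = {}"
    and "D = dijoin L R"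
    and "inversion_number L = 1" and "inversion_number R = 1"
    and "decycling_family D [X\<^sub>1, X\<^sub>2]"
  shows "(X\<^sub>1 \<subseteq> pverts L \<and> X\<^sub>2 \<subseteq> pverts R) \<or> (X\<^sub>1 \<subseteq> pverts R \<and> X\<^sub>2 \<subseteq> pverts L)"
proof -
  interpret L: oriented_graph L by fact
  interpret R: oriented_graph R by fact
  have "pair_wf_digraph D"
    unfolding \<open>D = dijoin L R\<close>
    by unfold_locales (auto simp: dijoin_def dest: L.wellformed' R.wellformed')
  then have "pair_wf_digraph (foldl invert D [X\<^sub>1, X\<^sub>2])" by (rule pair_wf_digraph_foldl_invert)
  then have "acyclic (parcs (foldl invert D [X\<^sub>1, X\<^sub>2]))"
    using assms(7) pair_wf_digraph.acyclic_digraph_iff unfolding decycling_family_def by blast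
  then have "acyclic (invert2 X\<^sub>1 X\<^sub>2 (parcs L \<union> parcs R \<union> pverts L \<times> pverts R))"
    unfolding parcs_foldl_invert_two \<open>D = dijoin L R\<close> by (simp add: dijoin_def)
  moreover have "\<not> acyclic (parcs L)" "\<not> acyclic (parcs R)"
    using not_acyclic_if_inversion_number_pos[of L] not_acyclic_if_inversion_number_pos[of R]
      assms(5,6) L.acyclic_digraph_iff R.acyclic_digraph_iff by auto
  moreover have "parcs L \<subseteq> pverts L \<times> pverts L" "parcs R \<subseteq> pverts R \<times> pverts R"
    by (auto dest: L.wellformed' R.wellformed')
  ultimately have "pverts L \<inter> X\<^sub>2 = {} \<and> pverts R \<inter> X\<^sub>1 = {} \<or> pverts L \<inter> X\<^sub>1 = {} \<and> pverts R \<inter> X\<^sub>2 = {}"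
    by (rule types_of_dijoin)
  \<comment> \<open>Within the vertices of \<open>D\<close>, avoiding one side means lying in the
    other.\<close>
  moreover have "X\<^sub>1 \<subseteq> pverts L \<union> pverts R" "X\<^sub>2 \<subseteq> pverts L \<union> pverts R"
    using assms(4,7) by (auto simp: decycling_family_def dijoin_def)
  ultimately show ?thesis by blast
qed

end
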